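(* Let $(H;\langle\cdot,\cdot\rangle)$ be an infinite dimensional Hilbert space over $\mathbb{K}$ and $(e_i)_{i\in\mathbb{N}}$ an orthonormal family in $H$. Let $\Gamma=(\Gamma_i)_{i\in\mathbb{N}},\ \gamma=(\gamma_i)_{i\in\mathbb{N}}\in\ell^2(\mathbb{K})$ with $\Gamma\ne\pm\gamma$, and let $x\in H$ be such that either $$\left\|x-\sum_{i=1}^\infty\frac{\Gamma_i+\gamma_i}{2}e_i\right\|\le\frac12\left(\sum_{i=1}^\infty|\Gamma_i-\gamma_i|^2\right)^{1/2}$$ or, equivalently, $$\operatorname{Re}\left\langle\sum_{i=1}^\infty\Gamma_ie_i-x,\ x-\sum_{i=1}^\infty\gamma_ie_i\right\rangle\ge0$$ holds. Then $$0\le\|x\|-\left(\sum_{i=1}^\infty|\langle x,e_i\rangle|^2\right)^{1/2}\le\frac14\cdot\frac{\sum_{i=1}^\infty|\Gamma_i-\gamma_i|^2}{\left(\sum_{i=1}^\infty|\Gamma_i+\gamma_i|^2\right)^{1/2}} .$$ The constant $\frac14$ is best possible, in the sense that it cannot be replaced by a smaller constant: there is no $c<\frac14$ such that the second inequality holds with $c$ in place of $\frac14$ for all infinite dimensional Hilbert spaces $H$ over $\mathbb{K}$, all orthonormal families $(e_i)_{i\in\mathbb{N}}$ in $H$, all $\Gamma,\gamma\in\ell^2(\mathbb{K})$ with $\Gamma\ne\pm\gamma$ and all $x\in H$ with $\operatorname{Re}\left\langle\sum_{i=1}^\infty\Gamma_ie_i-x,\ x-\sum_{i=1}^\infty\g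amma_ie_i\right\rangle\ge0$.
   Context: $\mathbb{K}$ denotes $\mathbb{R}$ or $\mathbb{C}$. Inner products are linear in the first argument and conjugate-linear in the second, and $\|x\|=\langle x,x\rangle^{1/2}$. A family $(e_i)_{i\in\mathbb{N}}$ is orthonormal if $\langle e_i,e_j\rangle=0$ for $i\ne j$ and $\|e_i\|=1$ for all $i$; it is not assumed to be complete. $\ell^2(\mathbb{K})$ is the space of sequences $(a_i)_{i\in\mathbb{N}}$ in $\mathbb{K}$ with $\sum_{i=1}^\infty|a_i|^2<\infty$; for $\lambda\in\ell^2(\mathbb{K})$ the series $\sum_i\lambda_ie_i$ converges in $H$. *)

theory Defs
  imports
    "HOL-Analysis.Analysis"
    "Jordan_Normal_Form.Missing_VectorSpace"
begin

text \<open>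
  Real and complex Hilbert spaces are treated uniformly, and with explicit carriers, so that a
  formula can quantify over all Hilbert spaces over a given field. The scalar field is a set
  \<open>K\<close> of complex numbers, used with \<open>K = \<real>\<close> and \<open>K = UNIV\<close> only.
  The type of the elements cannot be quantified inside a formula. A claim that something fails for
  some Hilbert space is therefore stated over the type \<open>nat \<Rightarrow> complex\<close>, which contains the
  sequence spaces; this is at least as strong as the claim over all types.
\<close>

definition scalars :: "complex set \<Rightarrow> complex ring" where
  "scalars K = \<lparr>carrier = K, mult = (*), one = 1, zero = 0, add = (+)\<rparr>"

text \<open>The fields \<open>mult\<close> and \<open>one\<close>, inherited from the library's record of modules, play no role.\<close>

record 'a ip_space = "(complex, 'a) module" +
  ip :: "'a \<Rightarrow> 'a \<Rightarrow> complex"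

definition ip_norm :: "('a, 'm) ip_space_scheme \<Rightarrow> 'a \<Rightarrow> real" where
  "ip_norm H x = sqrt (Re (ip H x x))"

text \<open>The value outside the carrier is needed because the locale \<open>Metric_space\<close> requires
  symmetry and nonnegativity of the distance on the whole type.\<close>

definition ip_dist :: "('a, 'm) ip_space_scheme \<Rightarrow> 'a \<Rightarrow> 'a \<Rightarrow> real" where
  "ip_dist H x y =
     (if x \<in> carrier H \<and> y \<in> carrier H then ip_norm H (x \<ominus>\<^bsub>H\<^esub> y) else 0)"

locale inner_product_space = vectorspace "scalars K" H
  for K :: "complex set" and H :: "('a, 'm) ip_space_scheme" +
  assumes ip_in_scalars: "\<lbrakk>x \<in> carrier H; y \<in> carrier H\<rbrakk> \<Longrightarrow> ip H x y \<in> K"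
    and ip_add_left: "\<lbrakk>x \<in> carrier H; y \<in> carrier H; z \<in> carrier H\<rbrakk>
      \<Longrightarrow> ip H (x \<oplus>\<^bsub>H\<^esub> y) z = ip H x z + ip H y z"
    and ip_smult_left: "\<lbrakk>a \<in> K; x \<in> carrier H; y \<in> carrier H\<rbrakk>
      \<Longrightarrow> ip H (a \<odot>\<^bsub>H\<^esub> x) y = a * ip H x y"
    and ip_commute: "\<lbrakk>x \<in> carrier H; y \<in> carrier H\<rbrakk> \<Longrightarrow> ip H y x = cnj (ip H x y)"
    and ip_nonneg: "x \<in> carrier H \<Longrightarrow> 0 \<le> Re (ip H x x)"
    and ip_definite: "\<lbrakk>x \<in> carrier H; ip H x x = 0\<rbrakk> \<Longrightarrow> x = \<zero>\<^bsub>H\<^esub>"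

locale hilbert_space = inner_product_space +
  assumes complete: "Metric_space.mcomplete (carrier H) (ip_dist H)"

definition infinite_dimensional :: "complex set \<Rightarrow> ('a, 'm) ip_space_scheme \<Rightarrow> bool" where
  "infinite_dimensional K H \<longleftrightarrow> \<not> vectorspace.fin_dim (scalars K) H"

definition orthonormal_family :: "('a, 'm) ip_space_scheme \<Rightarrow> (nat \<Rightarrow> 'a) \<Rightarrow> bool" where
  "orthonormal_family H e \<longleftrightarrow>
     (\<forall>i. e i \<in> carrier H) \<and>
     (\<forall>i j. i \<noteq> j \<longrightarrow> ip H (e i) (e j) = 0) \<and>
     (\<forall>i. ip_norm H (e i) = 1)"

definition ell2 :: "complex set \<Rightarrow> (nat \<Rightarrow> complex) set" where
  "ell2 K = {a. (\<forall>i. a i \<in> K) \<and> summable (\<lambda>i. (cmod (a i))\<^sup>2)}"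

definition series_sum :: "('a, 'm) ip_space_scheme \<Rightarrow> (nat \<Rightarrow> 'a) \<Rightarrow> 'a" where
  "series_sum H f =
     (THE s. limitin (Metric_space.mtopology (carrier H) (ip_dist H))
               (\<lambda>n. finsum H f {..<n}) s sequentially)"

definition expansion ::
  "('a, 'm) ip_space_scheme \<Rightarrow> (nat \<Rightarrow> 'a) \<Rightarrow> (nat \<Rightarrow> complex) \<Rightarrow> 'a" where
  "expansion H e a = series_sum H (\<lambda>i. a i \<odot>\<^bsub>H\<^esub> e i)"

text \<open>
  The following lemmas show that \<open>ip_dist\<close> makes the carrier a metric space, so that
  \<open>series_sum\<close> and completeness have their usual meaning, and that \<open>expansion\<close> is always
  the limit of a convergent series whenever the family is orthonormal and the coefficients
  lie in \<open>ell2 K\<close>.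
\<close>

context inner_product_space
begin

lemma smult_in [simp]: "a \<in> K \<Longrightarrow> x \<in> carrier H \<Longrightarrow> a \<odot>\<^bsub>H\<^esub> x \<in> carrier H"
  using smult_closed[of a x] by (simp add: scalars_def)

lemma ip_add_right:
  assumes "x \<in> carrier H" "y \<in> carrier H" "z \<in> carrier H"
  shows "ip H z (x \<oplus>\<^bsub>H\<^esub> y) = ip H z x + ip H z y"
proof -
  have "ip H z (x \<oplus>\<^bsub>H\<^esub> y) = cnj (ip H (x \<oplus>\<^bsub>H\<^esub> y) z)"
    using assms by (intro ip_commute) auto
  also have "\<dots> = cnj (ip H x z) + cnj (ip H y z)"
    using assms by (simp add: ip_add_left)
  finally show ?thesis
    using assms by (simp add: ip_commute[of _ z])
qed

lemma ip_smult_right: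
  assumes "a \<in> K" "x \<in> carrier H" "z \<in> carrier H"
  shows "ip H z (a \<odot>\<^bsub>H\<^esub> x) = cnj a * ip H z x"
proof -
  have "ip H z (a \<odot>\<^bsub>H\<^esub> x) = cnj (ip H (a \<odot>\<^bsub>H\<^esub> x) z)"
    using assms by (intro ip_commute) auto
  then show ?thesis
    using assms by (simp add: ip_smult_left ip_commute[of _ z])
qed

lemma ip_zero_left [simp]: "x \<in> carrier H \<Longrightarrow> ip H \<zero>\<^bsub>H\<^esub> x = 0"
  using ip_add_left[of "\<zero>\<^bsub>H\<^esub>" "\<zero>\<^bsub>H\<^esub>" x] by simp

lemma ip_zero_right [simp]: "x \<in> carrier H \<Longrightarrow> ip H x \<zero>\<^bsub>H\<^esub> = 0"
  using ip_commute[of "\<zero>\<^bsub>H\<^esub>" x] by simp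

lemma ip_self_real: "x \<in> carrier H \<Longrightarrow> ip H x x = of_real (Re (ip H x x))"
  using ip_commute[of x x] by (simp add: complex_eq_iff)

lemma ip_norm_nonneg: "x \<in> carrier H \<Longrightarrow> 0 \<le> ip_norm H x"
  by (simp add: ip_norm_def ip_nonneg)

lemma ip_norm_sq: "x \<in> carrier H \<Longrightarrow> (ip_norm H x)\<^sup>2 = Re (ip H x x)"
  by (simp add: ip_norm_def ip_nonneg)

lemma ip_norm_eq_0_iff: "x \<in> carrier H \<Longrightarrow> ip_norm H x = 0 \<longleftrightarrow> x = \<zero>\<^bsub>H\<^esub>"
  using ip_self_real[of x] ip_definite[of x] by (auto simp: ip_norm_def)

lemma ip_uminus_left:
  assumes "x \<in> carrier H" "y \<in> carrier H"
  shows "ip H (\<ominus>\<^bsub>H\<^esub> x) y = - ip H x y"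
  using ip_add_left[of x "\<ominus>\<^bsub>H\<^esub> x" y] assms by (simp add: r_neg add_eq_0_iff)

lemma ip_uminus_right:
  assumes "x \<in> carrier H" "y \<in> carrier H"
  shows "ip H y (\<ominus>\<^bsub>H\<^esub> x) = - ip H y x"
  using ip_add_right[of x "\<ominus>\<^bsub>H\<^esub> x" y] assms by (simp add: r_neg add_eq_0_iff)

lemma ip_norm_uminus: "x \<in> carrier H \<Longrightarrow> ip_norm H (\<ominus>\<^bsub>H\<^esub> x) = ip_norm H x"
  by (simp add: ip_norm_def ip_uminus_left ip_uminus_right)

lemma minus_in [simp]: "x \<in> carrier H \<Longrightarrow> y \<in> carrier H \<Longrightarrow> x \<ominus>\<^bsub>H\<^esub> y \<in> carrier H"
  by (simp add: a_minus_def)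

lemma ip_norm_add_sq:
  assumes "x \<in> carrier H" "y \<in> carrier H"
  shows "(ip_norm H (x \<oplus>\<^bsub>H\<^esub> y))\<^sup>2 = (ip_norm H x)\<^sup>2 + 2 * Re (ip H x y) + (ip_norm H y)\<^sup>2"
  using assms ip_commute[of x y]
  by (simp add: ip_norm_sq ip_add_left ip_add_right)

lemma Re_ip_le:
  assumes K: "K = \<real> \<or> K = UNIV" and x: "x \<in> carrier H" and y: "y \<in> carrier H"
  shows "Re (ip H x y) \<le> ip_norm H x * ip_norm H y"
proof (cases "ip_norm H x = 0 \<or> ip_norm H y = 0")
  case True
  then have "x = \<zero>\<^bsub>H\<^esub> \<or> y = \<zero>\<^bsub>H\<^esub>" using x y by (simp add: ip_norm_eq_0_iff)
  then show ?thesis using x y by (auto simp: ip_norm_def)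
next
  case False
  define a b where "a = ip_norm H x" and "b = ip_norm H y"
  have pos: "a > 0" "b > 0"
    using False ip_norm_nonneg x y unfolding a_def b_def by (auto simp: less_le)
  have aK: "complex_of_real b \<in> K" "complex_of_real (-a) \<in> K"
    using K by (auto simp: Reals_def)
  define u v where "u = complex_of_real b \<odot>\<^bsub>H\<^esub> x" and "v = complex_of_real (-a) \<odot>\<^bsub>H\<^esub> y"
  have uv: "u \<in> carrier H" "v \<in> carrier H"
    unfolding u_def v_def using aK x y by (blast intro: smult_in)+
  have uu: "(ip_norm H u)\<^sup>2 = b * b * a\<^sup>2"
    using uv x aK by (simp only: ip_norm_sq a_def) (simp add: u_def ip_smult_left ip_smult_right)
  have vv: "(ip_norm H v)\<^sup>2 = a * a * b\<^sup>2"
    using uv y aK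
    by (simp only: ip_norm_sq b_def)
       (simp add: v_def ip_smult_left ip_smult_right del: of_real_minus)
  have uv': "Re (ip H u v) = - (a * b * Re (ip H x y))"
    using uv x y aK by (simp add: u_def v_def ip_smult_left ip_smult_right del: of_real_minus)
  have "0 \<le> (ip_norm H u)\<^sup>2 + 2 * Re (ip H u v) + (ip_norm H v)\<^sup>2"
    using ip_norm_add_sq[OF uv] by (metis zero_le_power2)
  then have "0 \<le> (a * b) * (2 * (a * b - Re (ip H x y)))"
    unfolding uu vv uv' by (simp add: power2_eq_square algebra_simps)
  then show ?thesis
    using mult_pos_pos[OF pos] unfolding a_def[symmetric] b_def[symmetric]
    by (auto simp: zero_le_mult_iff[of "a * b"])
qed

lemma ip_norm_triangle:
  assumes K: "K = \<real> \<or> K = UNIV" and x: "x \<in> carrier H" and y: "y \<in> carrier H"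
  shows "ip_norm H (x \<oplus>\<^bsub>H\<^esub> y) \<le> ip_norm H x + ip_norm H y"
proof (rule power2_le_imp_le)
  show "(ip_norm H (x \<oplus>\<^bsub>H\<^esub> y))\<^sup>2 \<le> (ip_norm H x + ip_norm H y)\<^sup>2"
    using Re_ip_le[OF assms] x y by (simp add: ip_norm_add_sq power2_sum)
  show "0 \<le> ip_norm H x + ip_norm H y"
    using x y by (simp add: ip_norm_nonneg)
qed

lemma Metric_space:
  assumes K: "K = \<real> \<or> K = UNIV"
  shows "Metric_space (carrier H) (ip_dist H)"
proof
  fix x y
  show "0 \<le> ip_dist H x y"
    by (simp add: ip_dist_def ip_norm_nonneg)
  have "x \<ominus>\<^bsub>H\<^esub> y = \<ominus>\<^bsub>H\<^esub> (y \<ominus>\<^bsub>H\<^esub> x)" if "x \<in> carrier H" "y \<in> carrier H"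
    using that by (simp add: a_minus_def minus_add a_comm)
  then show "ip_dist H x y = ip_dist H y x"
    by (auto simp: ip_dist_def ip_norm_uminus)
next
  fix x y assume "x \<in> carrier H" "y \<in> carrier H"
  then show "ip_dist H x y = 0 \<longleftrightarrow> x = y"
    by (simp add: ip_dist_def ip_norm_eq_0_iff)
next
  fix x y z assume *: "x \<in> carrier H" "y \<in> carrier H" "z \<in> carrier H"
  then have "x \<ominus>\<^bsub>H\<^esub> z = (x \<ominus>\<^bsub>H\<^esub> y) \<oplus>\<^bsub>H\<^esub> (y \<ominus>\<^bsub>H\<^esub> z)"
    by (simp add: a_minus_def a_assoc r_neg2 r_neg1)
  then show "ip_dist H x z \<le> ip_dist H x y + ip_dist H y z"
    using * by (simp add: ip_dist_def ip_norm_triangle[OF K])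
qed

lemma ip_norm_sq_orthonormal_sum:
  assumes e: "orthonormal_family H e" and a: "\<And>i. a i \<in> K" and F: "finite F"
  shows "(ip_norm H (finsum H (\<lambda>i. a i \<odot>\<^bsub>H\<^esub> e i) F))\<^sup>2 = (\<Sum>i\<in>F. (cmod (a i))\<^sup>2)"
proof -
  have eH: "e i \<in> carrier H" for i using e by (simp add: orthonormal_family_def)
  have fs: "finsum H (\<lambda>i. a i \<odot>\<^bsub>H\<^esub> e i) A \<in> carrier H" for A
    using a eH by (intro finsum_closed) auto
  have orth: "ip H (a j \<odot>\<^bsub>H\<^esub> e j) (finsum H (\<lambda>i. a i \<odot>\<^bsub>H\<^esub> e i) A) = 0"
    if "finite A" "j \<notin> A" for A j
    using that
  proof (induction A)
    case (insert k A)
    then have "finsum H (\<lambda>i. a i \<odot>\<^bsub>H\<^esub> e i) (insert k A) =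
        a k \<odot>\<^bsub>H\<^esub> e k \<oplus>\<^bsub>H\<^esub> finsum H (\<lambda>i. a i \<odot>\<^bsub>H\<^esub> e i) A"
      using a eH by (intro finsum_insert) auto
    then show ?case
      using insert a eH fs e
      by (simp add: ip_add_right ip_smult_left ip_smult_right orthonormal_family_def)
  qed (use a eH in simp)
  have ee: "ip H (e k) (e k) = 1" for k
  proof -
    have "ip_norm H (e k) = 1" using e by (simp add: orthonormal_family_def)
    then have "Re (ip H (e k) (e k)) = 1" using ip_norm_sq[OF eH[of k]] by simp
    then show ?thesis using ip_self_real[OF eH[of k]] by simp
  qed
  from F show ?thesis
  proof (induction F)
    case empty
    then show ?case by (simp add: ip_norm_def)
  next
    case (insert k A)
    have "finsum H (\<lambda>i. a i \<odot>\<^bsub>H\<^esub> e i) (insert k A) =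
        a k \<odot>\<^bsub>H\<^esub> e k \<oplus>\<^bsub>H\<^esub> finsum H (\<lambda>i. a i \<odot>\<^bsub>H\<^esub> e i) A"
      using insert a eH by (intro finsum_insert) auto
    moreover have "(ip_norm H (a k \<odot>\<^bsub>H\<^esub> e k))\<^sup>2 = (cmod (a k))\<^sup>2"
      using a eH by (simp add: ip_norm_sq ip_smult_left ip_smult_right ee cmod_power2)
         (simp add: power2_eq_square)
    ultimately show ?case
      using insert orth[of A k] a eH fs by (simp add: ip_norm_add_sq)
  qed
qed

end

lemma (in hilbert_space) expansion_limit:
  assumes K: "K = \<real> \<or> K = UNIV" and e: "orthonormal_family H e" and a: "a \<in> ell2 K"
  shows "limitin (Metric_space.mtopology (carrier H) (ip_dist H))
           (\<lambda>n. finsum H (\<lambda>i. a i \<odot>\<^bsub>H\<^esub> e i) {..<n}) (expansion H e a) sequentially"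
proof -
  interpret M: Metric_space "carrier H" "ip_dist H" by (rule Metric_space[OF K])
  let ?S = "\<lambda>A. finsum H (\<lambda>i. a i \<odot>\<^bsub>H\<^esub> e i) A"
  have aK: "a i \<in> K" for i using a by (simp add: ell2_def)
  have eH: "e i \<in> carrier H" for i using e by (simp add: orthonormal_family_def)
  have fs: "?S A \<in> carrier H" for A
    using aK eH by (intro finsum_closed) auto
  have dist: "ip_dist H (?S {..<m}) (?S {..<n}) = sqrt (\<Sum>i\<in>{n..<m}. (cmod (a i))\<^sup>2)"
    if "n \<le> m" for m n
  proof -
    have "{..<m} = {..<n} \<union> {n..<m}" using that by auto
    then have "?S {..<m} = ?S {..<n} \<oplus>\<^bsub>H\<^esub> ?S {n..<m}"
      using aK eH by (simp only:) (intro finsum_Un_disjoint, auto)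
    then have "?S {..<m} \<ominus>\<^bsub>H\<^esub> ?S {..<n} = ?S {n..<m}"
      using fs[of "{..<n}"] fs[of "{n..<m}"] by (simp add: a_minus_def a_comm r_neg1)
    then have "ip_dist H (?S {..<m}) (?S {..<n}) = ip_norm H (?S {n..<m})"
      using fs by (simp add: ip_dist_def)
    also have "\<dots> = sqrt (\<Sum>i\<in>{n..<m}. (cmod (a i))\<^sup>2)"
      using ip_norm_sq_orthonormal_sum[OF e aK, of "{n..<m}"] ip_norm_nonneg[OF fs]
      by (intro real_sqrt_unique[symmetric]) auto
    finally show ?thesis .
  qed
  have "M.MCauchy (\<lambda>n. ?S {..<n})"
    unfolding M.MCauchy_def
  proof (intro conjI allI impI)
    fix \<epsilon> :: real assume "\<epsilon> > 0"
    moreover have "summable (\<lambda>i. (cmod (a i))\<^sup>2)" using a by (simp add: ell2_def)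
    ultimately obtain N where N: "\<And>m n. m \<ge> N \<Longrightarrow> norm (\<Sum>i\<in>{m..<n}. (cmod (a i))\<^sup>2) < \<epsilon>\<^sup>2"
      unfolding summable_Cauchy by (meson zero_less_power)
    have *: "ip_dist H (?S {..<m}) (?S {..<n}) < \<epsilon>" if "N \<le> n" "n \<le> m" for m n
      using N[OF that(1), of m] \<open>\<epsilon> > 0\<close> unfolding dist[OF that(2)]
      by (intro real_less_lsqrt) (auto simp: sum_nonneg)
    have "ip_dist H (?S {..<m}) (?S {..<n}) < \<epsilon>" if "N \<le> n" "N \<le> m" for m n
    proof (cases "n \<le> m")
      case True
      then show ?thesis using * that by simp
    next
      case False
      then show ?thesis using *[of m n] that by (subst M.commute) simp
    qed
    then show "\<exists>N. \<forall>n n'. N \<le> n \<longrightarrow> N \<le> n' \<longrightarrow> ip_dist H (?S {..<n}) (?S {..<n'}) < \<epsilon>"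
      by blast
  qed (use fs in auto)
  then obtain s where s: "limitin M.mtopology (\<lambda>n. ?S {..<n}) s sequentially"
    using complete unfolding M.mcomplete_def by blast
  then show ?thesis
    unfolding expansion_def series_sum_def
    by (rule theI) (auto intro: s M.limitin_metric_unique[OF _ s])
qed

end

theory Submission
  imports Defs
begin

text \<open>
  Let \<open>M\<close> and \<open>D\<close> be the expansions of half the sum and half the difference of \<open>\<Gamma>\<close> and \<open>\<gamma>\<close>.
  Then \<open>Re \<langle>M + D - x, x - (M - D)\<rangle> = \<parallel>D\<parallel>\<^sup>2 - \<parallel>x - M\<parallel>\<^sup>2\<close>, so both hypotheses say
  \<open>\<parallel>x - M\<parallel> \<le> \<parallel>D\<parallel>\<close>. With \<open>S\<close> the square root of the Bessel sum of \<open>x\<close>, the Cauchy--Schwarz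
  inequality for coefficients gives \<open>Re \<langle>x, M\<rangle> \<le> S \<parallel>M\<parallel>\<close>, whence
  \<open>2 \<parallel>x\<parallel> \<parallel>M\<parallel> \<le> \<parallel>x\<parallel>\<^sup>2 + \<parallel>M\<parallel>\<^sup>2 \<le> \<parallel>D\<parallel>\<^sup>2 + 2 S \<parallel>M\<parallel>\<close>; divide by \<open>2 \<parallel>M\<parallel>\<close>.
  Equality is attained in the plane spanned by two orthonormal vectors, only one of which belongs
  to the family.
\<close>

section \<open>Closure of the square-summable sequences under sums and scalar multiples\<close>

lemma ell2_add:
  assumes K: "K = \<real> \<or> K = UNIV" and a: "a \<in> ell2 K" and b: "b \<in> ell2 K"
  shows "(\<lambda>i. a i + b i) \<in> ell2 K"
proof -
  have "(cmod (a i + b i))\<^sup>2 \<le> 2 * (cmod (a i))\<^sup>2 + 2 * (cmod (b i))\<^sup>2" for i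
  proof -
    have "(cmod (a i + b i))\<^sup>2 \<le> (cmod (a i) + cmod (b i))\<^sup>2"
      by (intro power_mono norm_triangle_ineq) simp
    also have "\<dots> \<le> 2 * (cmod (a i))\<^sup>2 + 2 * (cmod (b i))\<^sup>2"
      using sum_squares_bound[of "cmod (a i)" "cmod (b i)"] by (simp add: power2_sum)
    finally show ?thesis .
  qed
  then have bound: "norm ((cmod (a i + b i))\<^sup>2) \<le> 2 * (cmod (a i))\<^sup>2 + 2 * (cmod (b i))\<^sup>2" for i
    by simp
  have "summable (\<lambda>i. 2 * (cmod (a i))\<^sup>2 + 2 * (cmod (b i))\<^sup>2)"
    using a b by (intro summable_add summable_mult) (simp_all add: ell2_def)
  then have "summable (\<lambda>i. (cmod (a i + b i))\<^sup>2)"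
    using bound by (rule summable_comparison_test'[where N = 0])
  then show ?thesis
    using a b K by (auto simp: ell2_def)
qed

lemma ell2_scale:
  assumes K: "K = \<real> \<or> K = UNIV" and c: "c \<in> K" and a: "a \<in> ell2 K"
  shows "(\<lambda>i. c * a i) \<in> ell2 K"
  using a c K by (auto simp: ell2_def norm_mult power_mult_distrib intro: summable_mult)

section \<open>Finite orthonormal sums and Bessel's inequality\<close>

context inner_product_space
begin

lemma ip_finsum_right:
  assumes "finite A" and "\<And>i. i \<in> A \<Longrightarrow> f i \<in> carrier H" and y: "y \<in> carrier H"
  shows "ip H y (finsum H f A) = (\<Sum>i\<in>A. ip H y (f i))"
  using assms(1,2)
proof (induction A)
  case (insert i A)
  then have "finsum H f (insert i A) = f i \<oplus>\<^bsub>H\<^esub> finsum H f A"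
    by (intro finsum_insert) auto
  moreover have "finsum H f A \<in> carrier H"
    using insert.prems by (intro finsum_closed) auto
  ultimately show ?case
    using insert y by (simp add: ip_add_right)
qed (use y in simp)

lemma ip_orthonormal:
  assumes "orthonormal_family H e"
  shows "ip H (e i) (e j) = (if i = j then 1 else 0)"
proof -
  have e: "e i \<in> carrier H" "ip_norm H (e i) = 1"
    using assms by (simp_all add: orthonormal_family_def)
  then have "ip H (e i) (e i) = 1"
    using ip_norm_sq[OF e(1)] ip_self_real[OF e(1)] by simp
  then show ?thesis
    using assms by (auto simp: orthonormal_family_def)
qed

lemma ip_orthonormal_sum:
  assumes e: "orthonormal_family H e" and a: "\<And>i. a i \<in> K" and F: "finite F"
    and y: "y \<in> carrier H"
  shows "ip H y (finsum H (\<lambda>i. a i \<odot>\<^bsub>H\<^esub> e i) F) = (\<Sum>i\<in>F. cnj (a i) * ip H y (e i))"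
proof -
  have eH: "e i \<in> carrier H" for i using e by (simp add: orthonormal_family_def)
  show ?thesis
    using a eH y F by (subst ip_finsum_right) (auto simp: ip_smult_right intro!: sum.cong)
qed

text \<open>Pairing a vanishing combination with \<open>e k\<close> isolates the conjugate of its
  \<open>k\<close>-th coefficient, so \<open>range e\<close> is an infinite independent set. This
  qualifies the concrete space used for sharpness.\<close>

lemma orthonormal_infinite_dimensional:
  assumes K: "K = \<real> \<or> K = UNIV" and e: "orthonormal_family H e"
  shows "infinite_dimensional K H"
proof -
  have eH: "e i \<in> carrier H" for i using e by (simp add: orthonormal_family_def)
  have inj: "inj e"
  proof (rule injI)
    fix i j assume "e i = e j"
    then show "i = j" using ip_orthonormal[OF e, of i j] ip_orthonormal[OF e, of j j]
      by (auto split: if_splits)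
  qed
  have "lin_indpt (range e)"
  proof
    assume "lin_dep (range e)"
    then obtain A a v where A: "finite A" "A \<subseteq> range e" "a \<in> A \<rightarrow> carrier (scalars K)"
      "lincomb a A = \<zero>\<^bsub>H\<^esub>" "v \<in> A" "a v \<noteq> \<zero>\<^bsub>scalars K\<^esub>"
      unfolding lin_dep_def by blast
    \<comment> \<open>The relation is indexed by vectors; passing to indices in \<open>F\<close>
      makes orthonormality applicable.\<close>
    then obtain F where F: "finite F" "A = e ` F"
      by (meson finite_subset_image)
    obtain k where k: "k \<in> F" "v = e k" using A F by auto
    have aK: "a (e i) \<in> K" if "i \<in> F" for i
      using A(3) F that by (auto simp: scalars_def)
    have "ip H (e k) (finsum H (\<lambda>i. a (e i) \<odot>\<^bsub>H\<^esub> e i) F) =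
        (\<Sum>i\<in>F. ip H (e k) (a (e i) \<odot>\<^bsub>H\<^esub> e i))"
      using F aK eH by (intro ip_finsum_right) auto
    also have "\<dots> = (\<Sum>i\<in>F. if i = k then cnj (a (e k)) else 0)"
      using aK eH by (intro sum.cong) (auto simp: ip_smult_right ip_orthonormal[OF e])
    also have "\<dots> = cnj (a v)"
      using F(1) k by simp
    also have "finsum H (\<lambda>i. a (e i) \<odot>\<^bsub>H\<^esub> e i) F = lincomb a A"
      unfolding lincomb_def F(2) using aK eH inj
      by (subst add.finprod_reindex) (auto intro: inj_on_subset)
    finally show False
      using A(4,6) eH by (simp add: scalars_def)
  qed
  then have "\<not> fin_dim"
    using fin_dim_li_fin[of "range e"] eH inj by (auto simp: range_inj_infinite)
  then show ?thesis
    by (simp add: infinite_dimensional_def)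
qed

text \<open>The projection \<open>P\<close> of \<open>x\<close> onto the first \<open>n\<close>
  vectors satisfies \<open>Re (ip H x P) = (ip_norm H P)\<^sup>2\<close>, so Cauchy--Schwarz gives
  the bound after cancelling one factor \<open>ip_norm H P\<close>.\<close>

lemma Bessel_partial:
  assumes K: "K = \<real> \<or> K = UNIV" and e: "orthonormal_family H e" and x: "x \<in> carrier H"
  shows "(\<Sum>i<n. (cmod (ip H x (e i)))\<^sup>2) \<le> (ip_norm H x)\<^sup>2"
proof -
  define P where "P = finsum H (\<lambda>i. ip H x (e i) \<odot>\<^bsub>H\<^esub> e i) {..<n}"
  have eH: "e i \<in> carrier H" for i using e by (simp add: orthonormal_family_def)
  have xK: "ip H x (e i) \<in> K" for i using ip_in_scalars x eH by auto
  have P: "P \<in> carrier H" unfolding P_def using xK eH by (intro finsum_closed) auto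
  have PP: "(ip_norm H P)\<^sup>2 = (\<Sum>i<n. (cmod (ip H x (e i)))\<^sup>2)"
    unfolding P_def by (intro ip_norm_sq_orthonormal_sum e xK) simp
  have "ip H x P = (\<Sum>i<n. of_real ((cmod (ip H x (e i)))\<^sup>2))"
    unfolding P_def using e xK x
    by (subst ip_orthonormal_sum) (auto simp: complex_norm_square[symmetric] mult.commute[of "cnj _"] intro!: sum.cong)
  then have "(ip_norm H P)\<^sup>2 = Re (ip H x P)"
    by (simp add: PP)
  also have "\<dots> \<le> ip_norm H x * ip_norm H P"
    using K x P by (rule Re_ip_le)
  finally have "ip_norm H P \<le> ip_norm H x"
    using ip_norm_nonneg[OF P] ip_norm_nonneg[OF x]
    by (cases "ip_norm H P = 0") (auto simp: power2_eq_square)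
  then show ?thesis
    unfolding PP[symmetric] by (intro power_mono ip_norm_nonneg P)
qed

lemma Bessel:
  assumes K: "K = \<real> \<or> K = UNIV" and e: "orthonormal_family H e" and x: "x \<in> carrier H"
  shows "summable (\<lambda>i. (cmod (ip H x (e i)))\<^sup>2)"
    and "sqrt (\<Sum>i. (cmod (ip H x (e i)))\<^sup>2) \<le> ip_norm H x"
proof -
  show *: "summable (\<lambda>i. (cmod (ip H x (e i)))\<^sup>2)"
    \<comment> \<open>The summability criterion takes partial sums over \<open>{..n}\<close>, hence
      the shift by one.\<close>
    using Bessel_partial[OF assms, of "Suc _"]
    by (intro bounded_imp_summable[of _ "(ip_norm H x)\<^sup>2"]) (auto simp: lessThan_Suc_atMost)
  have "(\<Sum>i. (cmod (ip H x (e i)))\<^sup>2) \<le> (ip_norm H x)\<^sup>2"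
    using Bessel_partial[OF assms] * by (intro suminf_le_const)
  then show "sqrt (\<Sum>i. (cmod (ip H x (e i)))\<^sup>2) \<le> ip_norm H x"
    using ip_norm_nonneg[OF x] by (intro real_le_lsqrt) auto
qed

text \<open>Cauchy--Schwarz is applied to the coefficient sequences, not to the vectors: this puts
  the Bessel root where the vector version would put \<open>ip_norm H x\<close>. The bound does not
  depend on \<open>n\<close>, so it survives the limit.\<close>

lemma Re_ip_orthonormal_sum_le:
  assumes K: "K = \<real> \<or> K = UNIV" and e: "orthonormal_family H e" and a: "a \<in> ell2 K"
    and x: "x \<in> carrier H"
  shows "Re (ip H x (finsum H (\<lambda>i. a i \<odot>\<^bsub>H\<^esub> e i) {..<n}))
    \<le> sqrt (\<Sum>i. (cmod (ip H x (e i)))\<^sup>2) * sqrt (\<Sum>i. (cmod (a i))\<^sup>2)"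
proof -
  let ?u = "\<lambda>i. cmod (ip H x (e i))" and ?a = "\<lambda>i. cmod (a i)"
  have aK: "a i \<in> K" and sa: "summable (\<lambda>i. (?a i)\<^sup>2)" for i using a by (simp_all add: ell2_def)
  have "Re (ip H x (finsum H (\<lambda>i. a i \<odot>\<^bsub>H\<^esub> e i) {..<n})) \<le>
      cmod (\<Sum>i<n. cnj (a i) * ip H x (e i))"
    using ip_orthonormal_sum[OF e aK _ x, of "{..<n}"] by (simp only: finite_lessThan complex_Re_le_cmod)
  also have "\<dots> \<le> (\<Sum>i<n. \<bar>?u i\<bar> * \<bar>?a i\<bar>)"
    by (rule order_trans[OF norm_sum]) (simp add: norm_mult mult.commute)
  also have "\<dots> \<le> L2_set ?u {..<n} * L2_set ?a {..<n}"
    by (rule L2_set_mult_ineq)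
  also have "\<dots> \<le> sqrt (\<Sum>i. (?u i)\<^sup>2) * sqrt (\<Sum>i. (?a i)\<^sup>2)"
    unfolding L2_set_def using Bessel(1)[OF K e x] sa
    by (intro mult_mono real_sqrt_le_mono sum_le_suminf) (auto intro!: sum_nonneg suminf_nonneg)
  finally show ?thesis .
qed

section \<open>Continuity of inner product, norm and addition along metric limits\<close>

lemma limitin_Re_ip:
  assumes K: "K = \<real> \<or> K = UNIV" and x: "x \<in> carrier H"
    and f: "limitin (Metric_space.mtopology (carrier H) (ip_dist H)) f s sequentially"
  shows "(\<lambda>n. Re (ip H x (f n))) \<longlonglongrightarrow> Re (ip H x s)"
proof -
  interpret M: Metric_space "carrier H" "ip_dist H" by (rule Metric_space[OF K])
  have s: "s \<in> carrier H" and ev: "eventually (\<lambda>n. f n \<in> carrier H) sequentially"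
    and lim: "(\<lambda>n. ip_dist H (f n) s) \<longlonglongrightarrow> 0"
    using f unfolding M.limitin_metric_dist_null by auto
  have "eventually (\<lambda>n. norm (Re (ip H x (f n)) - Re (ip H x s)) \<le> ip_norm H x * ip_dist H (f n) s)
      sequentially"
    using ev
  proof eventually_elim
    case (elim n)
    have eq: "Re (ip H x (f n)) - Re (ip H x s) = Re (ip H x (f n \<ominus>\<^bsub>H\<^esub> s))"
      using elim s x by (simp add: a_minus_def ip_add_right ip_uminus_right)
    have "Re (ip H x (f n \<ominus>\<^bsub>H\<^esub> s)) \<le> ip_norm H x * ip_norm H (f n \<ominus>\<^bsub>H\<^esub> s)"
      using elim s x K by (intro Re_ip_le) auto
    \<comment> \<open>Cauchy--Schwarz is available for the real part only; using it for the negative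
      of \<open>x\<close> as well bounds the absolute value.\<close>
    moreover have "Re (ip H (\<ominus>\<^bsub>H\<^esub> x) (f n \<ominus>\<^bsub>H\<^esub> s)) \<le> ip_norm H x * ip_norm H (f n \<ominus>\<^bsub>H\<^esub> s)"
      using Re_ip_le[OF K, of "\<ominus>\<^bsub>H\<^esub> x" "f n \<ominus>\<^bsub>H\<^esub> s"] elim s x by (simp add: ip_norm_uminus)
    ultimately show ?case
      unfolding eq using elim s x by (simp add: ip_dist_def ip_uminus_left)
  qed
  moreover have "(\<lambda>n. ip_norm H x * ip_dist H (f n) s) \<longlonglongrightarrow> 0"
    using tendsto_mult_left[OF lim, of "ip_norm H x"] by simp
  ultimately have "(\<lambda>n. Re (ip H x (f n)) - Re (ip H x s)) \<longlonglongrightarrow> 0"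
    by (rule Lim_null_comparison)
  then show ?thesis
    by (simp add: LIM_zero_iff)
qed

text \<open>The norm is the distance to zero, so the triangle inequality used in both directions
  makes it 1-Lipschitz.\<close>

lemma limitin_ip_norm:
  assumes K: "K = \<real> \<or> K = UNIV"
    and f: "limitin (Metric_space.mtopology (carrier H) (ip_dist H)) f s sequentially"
  shows "(\<lambda>n. ip_norm H (f n)) \<longlonglongrightarrow> ip_norm H s"
proof -
  interpret M: Metric_space "carrier H" "ip_dist H" by (rule Metric_space[OF K])
  have s: "s \<in> carrier H" and ev: "eventually (\<lambda>n. f n \<in> carrier H) sequentially"
    and lim: "(\<lambda>n. ip_dist H (f n) s) \<longlonglongrightarrow> 0"
    using f unfolding M.limitin_metric_dist_null by auto
  have norm: "ip_norm H y = ip_dist H y \<zero>\<^bsub>H\<^esub>" if "y \<in> carrier H" for y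
  proof -
    have "\<ominus>\<^bsub>H\<^esub> \<zero>\<^bsub>H\<^esub> = \<zero>\<^bsub>H\<^esub>" by (rule minus_equality) simp_all
    then have "y \<ominus>\<^bsub>H\<^esub> \<zero>\<^bsub>H\<^esub> = y" using that by (simp only: a_minus_def r_zero)
    then show ?thesis using that by (simp add: ip_dist_def)
  qed
  have "eventually (\<lambda>n. norm (ip_norm H (f n) - ip_norm H s) \<le> ip_dist H (f n) s) sequentially"
    using ev
  proof eventually_elim
    case (elim n)
    then show ?case
      using M.triangle[of "f n" s "\<zero>\<^bsub>H\<^esub>"] M.triangle[of s "f n" "\<zero>\<^bsub>H\<^esub>"] s M.commute[of s "f n"]
      by (simp add: norm abs_le_iff)
  qed
  then have "(\<lambda>n. ip_norm H (f n) - ip_norm H s) \<longlonglongrightarrow> 0"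
    using lim by (rule Lim_null_comparison)
  then show ?thesis
    by (simp add: LIM_zero_iff)
qed

lemma limitin_ip_add:
  assumes K: "K = \<real> \<or> K = UNIV"
    and f: "limitin (Metric_space.mtopology (carrier H) (ip_dist H)) f s sequentially"
    and g: "limitin (Metric_space.mtopology (carrier H) (ip_dist H)) g t sequentially"
  shows "limitin (Metric_space.mtopology (carrier H) (ip_dist H))
    (\<lambda>n. f n \<oplus>\<^bsub>H\<^esub> g n) (s \<oplus>\<^bsub>H\<^esub> t) sequentially"
proof -
  interpret M: Metric_space "carrier H" "ip_dist H" by (rule Metric_space[OF K])
  have s: "s \<in> carrier H" and evf: "eventually (\<lambda>n. f n \<in> carrier H) sequentially"
    and limf: "(\<lambda>n. ip_dist H (f n) s) \<longlonglongrightarrow> 0"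
    using f unfolding M.limitin_metric_dist_null by auto
  have t: "t \<in> carrier H" and evg: "eventually (\<lambda>n. g n \<in> carrier H) sequentially"
    and limg: "(\<lambda>n. ip_dist H (g n) t) \<longlonglongrightarrow> 0"
    using g unfolding M.limitin_metric_dist_null by auto
  have "eventually (\<lambda>n. norm (ip_dist H (f n \<oplus>\<^bsub>H\<^esub> g n) (s \<oplus>\<^bsub>H\<^esub> t))
      \<le> ip_dist H (f n) s + ip_dist H (g n) t) sequentially"
    using evf evg
  proof eventually_elim
    case (elim n)
    then have "(f n \<oplus>\<^bsub>H\<^esub> g n) \<ominus>\<^bsub>H\<^esub> (s \<oplus>\<^bsub>H\<^esub> t) = (f n \<ominus>\<^bsub>H\<^esub> s) \<oplus>\<^bsub>H\<^esub> (g n \<ominus>\<^bsub>H\<^esub> t)"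
      using s t by (simp add: a_minus_def minus_add a_ac)
    then show ?case
      using elim s t by (simp add: ip_dist_def ip_norm_nonneg ip_norm_triangle[OF K])
  qed
  moreover have "(\<lambda>n. ip_dist H (f n) s + ip_dist H (g n) t) \<longlonglongrightarrow> 0"
    using tendsto_add[OF limf limg] by simp
  ultimately have "(\<lambda>n. ip_dist H (f n \<oplus>\<^bsub>H\<^esub> g n) (s \<oplus>\<^bsub>H\<^esub> t)) \<longlonglongrightarrow> 0"
    by (rule Lim_null_comparison)
  moreover have "eventually (\<lambda>n. f n \<oplus>\<^bsub>H\<^esub> g n \<in> carrier H) sequentially"
    using evf evg by eventually_elim simp
  ultimately show ?thesis
    unfolding M.limitin_metric_dist_null using s t by simp
qed

end

section \<open>Calculus of orthonormal expansions\<close>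

context hilbert_space
begin

lemma expansion_in:
  assumes "K = \<real> \<or> K = UNIV" "orthonormal_family H e" "a \<in> ell2 K"
  shows "expansion H e a \<in> carrier H"
  using expansion_limit[OF assms] Metric_space.limitin_mspace[OF Metric_space[OF assms(1)]] by blast

text \<open>\<open>expansion\<close> is a definite description; uniqueness of limits allows it to be
  computed by exhibiting any limit of the partial sums.\<close>

lemma expansion_eqI:
  assumes K: "K = \<real> \<or> K = UNIV" and e: "orthonormal_family H e" and a: "a \<in> ell2 K"
    and s: "limitin (Metric_space.mtopology (carrier H) (ip_dist H))
      (\<lambda>n. finsum H (\<lambda>i. a i \<odot>\<^bsub>H\<^esub> e i) {..<n}) s sequentially"
  shows "expansion H e a = s"
  using Metric_space.limitin_metric_unique[OF Metric_space[OF K] expansion_limit[OF K e a] s] by simp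

text \<open>Transfers identities between coefficient sequences to the vectors they
  represent.\<close>

lemma expansion_add:
  assumes K: "K = \<real> \<or> K = UNIV" and e: "orthonormal_family H e"
    and a: "a \<in> ell2 K" and b: "b \<in> ell2 K"
  shows "expansion H e (\<lambda>i. a i + b i) = expansion H e a \<oplus>\<^bsub>H\<^esub> expansion H e b"
proof (rule expansion_eqI[OF K e ell2_add[OF K a b]])
  have eH: "e i \<in> carrier H" for i using e by (simp add: orthonormal_family_def)
  have aK: "a i \<in> K" and bK: "b i \<in> K" for i using a b by (simp_all add: ell2_def)
  have "finsum H (\<lambda>i. (a i + b i) \<odot>\<^bsub>H\<^esub> e i) {..<n} =
      finsum H (\<lambda>i. a i \<odot>\<^bsub>H\<^esub> e i) {..<n} \<oplus>\<^bsub>H\<^esub> finsum H (\<lambda>i. b i \<odot>\<^bsub>H\<^esub> e i) {..<n}" for n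
  proof -
    have "(a i + b i) \<odot>\<^bsub>H\<^esub> e i = a i \<odot>\<^bsub>H\<^esub> e i \<oplus>\<^bsub>H\<^esub> b i \<odot>\<^bsub>H\<^esub> e i" for i
      using smult_l_distr[of "a i" "b i" "e i"] aK bK eH by (simp add: scalars_def)
    then show ?thesis
      using aK bK eH by (simp add: finsum_addf Pi_def)
  qed
  then show "limitin (Metric_space.mtopology (carrier H) (ip_dist H))
      (\<lambda>n. finsum H (\<lambda>i. (a i + b i) \<odot>\<^bsub>H\<^esub> e i) {..<n})
      (expansion H e a \<oplus>\<^bsub>H\<^esub> expansion H e b) sequentially"
    using limitin_ip_add[OF K expansion_limit[OF K e a] expansion_limit[OF K e b]] by simp
qed

text \<open>The partial sums are constant once they include index \<open>j\<close>, that is from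
  \<open>Suc j\<close> terms on. The extremal example has coefficients of this kind.\<close>

lemma expansion_single:
  assumes K: "K = \<real> \<or> K = UNIV" and e: "orthonormal_family H e" and c: "c \<in> K"
  shows "expansion H e (\<lambda>i. if i = j then c else 0) = c \<odot>\<^bsub>H\<^esub> e j"
proof (rule expansion_eqI[OF K e])
  let ?a = "\<lambda>i. if i = j then c else 0"
  have eH: "e i \<in> carrier H" for i using e by (simp add: orthonormal_family_def)
  have zero: "0 \<in> K" using K by auto
  have "summable (\<lambda>i. (cmod (?a i))\<^sup>2)"
    by (rule summable_finite[of "{j}"]) auto
  then show "?a \<in> ell2 K"
    using c zero by (auto simp: ell2_def)
  interpret M: Metric_space "carrier H" "ip_dist H" by (rule Metric_space[OF K])
  have z: "(0::complex) \<odot>\<^bsub>H\<^esub> e i = \<zero>\<^bsub>H\<^esub>" for i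
    using smult_l_null[of "e i"] eH by (simp add: scalars_def)
  have "finsum H (\<lambda>i. ?a i \<odot>\<^bsub>H\<^esub> e i) {..<n} = c \<odot>\<^bsub>H\<^esub> e j" if "j < n" for n
  proof -
    have "finsum H (\<lambda>i. ?a i \<odot>\<^bsub>H\<^esub> e i) {..<n} =
        finsum H (\<lambda>i. if j = i then c \<odot>\<^bsub>H\<^esub> e i else \<zero>\<^bsub>H\<^esub>) {..<n}"
      using c eH z by (intro finsum_cong') auto
    also have "\<dots> = c \<odot>\<^bsub>H\<^esub> e j"
      using that c eH by (intro add.finprod_singleton) auto
    finally show ?thesis .
  qed
  then have "eventually (\<lambda>n. finsum H (\<lambda>i. ?a i \<odot>\<^bsub>H\<^esub> e i) {..<n} = c \<odot>\<^bsub>H\<^esub> e j) sequentially"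
    by (intro eventually_sequentiallyI[of "Suc j"]) simp
  then show "limitin M.mtopology (\<lambda>n. finsum H (\<lambda>i. ?a i \<odot>\<^bsub>H\<^esub> e i) {..<n})
      (c \<odot>\<^bsub>H\<^esub> e j) sequentially"
    using c eH by (intro limitin_eventually) auto
qed

text \<open>Pythagoras for the partial sums, taken to the limit on both sides: norms converge by
  continuity, square sums by summability.\<close>

lemma ip_norm_expansion:
  assumes K: "K = \<real> \<or> K = UNIV" and e: "orthonormal_family H e" and a: "a \<in> ell2 K"
  shows "ip_norm H (expansion H e a) = sqrt (\<Sum>i. (cmod (a i))\<^sup>2)"
proof -
  have eH: "e i \<in> carrier H" for i using e by (simp add: orthonormal_family_def)
  have aK: "a i \<in> K" and sa: "summable (\<lambda>i. (cmod (a i))\<^sup>2)" for i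
    using a by (simp_all add: ell2_def)
  have "ip_norm H (finsum H (\<lambda>i. a i \<odot>\<^bsub>H\<^esub> e i) {..<n}) = sqrt (\<Sum>i<n. (cmod (a i))\<^sup>2)" for n
    using ip_norm_sq_orthonormal_sum[OF e aK, of "{..<n}"] aK eH
    by (intro real_sqrt_unique[symmetric]) (auto intro!: ip_norm_nonneg finsum_closed)
  then have "(\<lambda>n. sqrt (\<Sum>i<n. (cmod (a i))\<^sup>2)) \<longlonglongrightarrow> ip_norm H (expansion H e a)"
    using limitin_ip_norm[OF K expansion_limit[OF K e a]] by simp
  moreover have "(\<lambda>n. sqrt (\<Sum>i<n. (cmod (a i))\<^sup>2)) \<longlonglongrightarrow> sqrt (\<Sum>i. (cmod (a i))\<^sup>2)"
    using sa by (intro tendsto_real_sqrt summable_LIMSEQ)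
  ultimately show ?thesis
    by (rule LIMSEQ_unique)
qed

lemma Re_ip_expansion_le:
  assumes K: "K = \<real> \<or> K = UNIV" and e: "orthonormal_family H e" and a: "a \<in> ell2 K"
    and x: "x \<in> carrier H"
  shows "Re (ip H x (expansion H e a))
    \<le> sqrt (\<Sum>i. (cmod (ip H x (e i)))\<^sup>2) * ip_norm H (expansion H e a)"
  using LIMSEQ_le_const2[OF limitin_Re_ip[OF K x expansion_limit[OF K e a]]]
    Re_ip_orthonormal_sum_le[OF K e a x] by (auto simp: ip_norm_expansion[OF K e a])

section \<open>Equivalence of the two hypotheses and the upper bound\<close>

text \<open>Both claims share the vectors \<open>M\<close>, \<open>D\<close> and
  \<open>y = x - M\<close>, hence the joint proof. The upper bound starts from the ball condition;
  the equivalence carries it over to the other hypothesis.\<close>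

lemma
  assumes K: "K = \<real> \<or> K = UNIV" and e: "orthonormal_family H e"
    and \<Gamma>: "\<Gamma> \<in> ell2 K" and \<gamma>: "\<gamma> \<in> ell2 K" and x: "x \<in> carrier H"
  shows ball_iff_Re_ip:
      "ip_norm H (x \<ominus>\<^bsub>H\<^esub> expansion H e (\<lambda>i. (\<Gamma> i + \<gamma> i) / 2))
          \<le> 1 / 2 * sqrt (\<Sum>i. (cmod (\<Gamma> i - \<gamma> i))\<^sup>2)
        \<longleftrightarrow> 0 \<le> Re (ip H (expansion H e \<Gamma> \<ominus>\<^bsub>H\<^esub> x) (x \<ominus>\<^bsub>H\<^esub> expansion H e \<gamma>))"
    and reverse_Bessel:
      "\<lbrakk>\<Gamma> \<noteq> (\<lambda>i. - \<gamma> i);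
        ip_norm H (x \<ominus>\<^bsub>H\<^esub> expansion H e (\<lambda>i. (\<Gamma> i + \<gamma> i) / 2))
          \<le> 1 / 2 * sqrt (\<Sum>i. (cmod (\<Gamma> i - \<gamma> i))\<^sup>2)\<rbrakk> \<Longrightarrow>
       ip_norm H x - sqrt (\<Sum>i. (cmod (ip H x (e i)))\<^sup>2)
         \<le> 1 / 4 * ((\<Sum>i. (cmod (\<Gamma> i - \<gamma> i))\<^sup>2) / sqrt (\<Sum>i. (cmod (\<Gamma> i + \<gamma> i))\<^sup>2))"
proof -
  define m d where "m = (\<lambda>i. (\<Gamma> i + \<gamma> i) / 2)" and "d = (\<lambda>i. (\<Gamma> i - \<gamma> i) / 2)"
  define M D where "M = expansion H e m" and "D = expansion H e d"
  have half: "1 / 2 \<in> K" "- 1 \<in> K" using K by (auto simp: Reals_minus_iff intro!: Reals_divide)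
  have sum: "(\<lambda>i. \<Gamma> i + \<gamma> i) \<in> ell2 K" and diff: "(\<lambda>i. \<Gamma> i - \<gamma> i) \<in> ell2 K"
    using ell2_add[OF K \<Gamma> \<gamma>] ell2_add[OF K \<Gamma> ell2_scale[OF K half(2) \<gamma>]] by simp_all
  have m: "m \<in> ell2 K" and d: "d \<in> ell2 K"
    using ell2_scale[OF K half(1) sum] ell2_scale[OF K half(1) diff] by (simp_all add: m_def d_def)
  have \<gamma>': "expansion H e \<gamma> \<in> carrier H" and M: "M \<in> carrier H" and D: "D \<in> carrier H"
    unfolding M_def D_def by (intro expansion_in K e \<gamma> m d)+
  have norm_half: "sqrt (\<Sum>i. (cmod (a i / 2))\<^sup>2) = 1 / 2 * sqrt (\<Sum>i. (cmod (a i))\<^sup>2)"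
    if "a \<in> ell2 K" for a
  proof -
    have "(\<Sum>i. (cmod (a i / 2))\<^sup>2) = (\<Sum>i. (cmod (a i))\<^sup>2) / 4"
      using that by (simp add: norm_divide power_divide suminf_divide ell2_def)
    then show ?thesis by (simp only: real_sqrt_divide real_sqrt_four)
  qed
  have nM: "ip_norm H M = 1 / 2 * sqrt (\<Sum>i. (cmod (\<Gamma> i + \<gamma> i))\<^sup>2)"
    unfolding M_def ip_norm_expansion[OF K e m] unfolding m_def using norm_half[OF sum] .
  have nD: "ip_norm H D = 1 / 2 * sqrt (\<Sum>i. (cmod (\<Gamma> i - \<gamma> i))\<^sup>2)"
    unfolding D_def ip_norm_expansion[OF K e d] unfolding d_def using norm_half[OF diff] .
  have \<Gamma>_eq: "expansion H e \<Gamma> = M \<oplus>\<^bsub>H\<^esub> D"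
    unfolding M_def D_def expansion_add[OF K e m d, symmetric]
    by (rule arg_cong[of _ _ "expansion H e"]) (auto simp: m_def d_def field_simps)
  have M_eq: "M = expansion H e \<gamma> \<oplus>\<^bsub>H\<^esub> D"
    unfolding M_def D_def expansion_add[OF K e \<gamma> d, symmetric]
    by (rule arg_cong[of _ _ "expansion H e"]) (auto simp: m_def d_def field_simps)
  \<comment> \<open>Solving \<open>M_eq\<close> for the expansion of \<open>\<gamma>\<close> reduces
    subtraction to the additivity of \<open>expansion\<close>.\<close>
  have \<gamma>_eq: "expansion H e \<gamma> = M \<ominus>\<^bsub>H\<^esub> D"
    using M_eq \<gamma>' D by (simp add: a_minus_def a_assoc r_neg)
  define y where "y = x \<ominus>\<^bsub>H\<^esub> M"
  have y: "y \<in> carrier H" using x M by (simp add: y_def)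
  have 1: "expansion H e \<Gamma> \<ominus>\<^bsub>H\<^esub> x = D \<ominus>\<^bsub>H\<^esub> y"
    unfolding \<Gamma>_eq y_def using x M D by (simp add: a_minus_def minus_add a_ac)
  have 2: "x \<ominus>\<^bsub>H\<^esub> expansion H e \<gamma> = y \<oplus>\<^bsub>H\<^esub> D"
    unfolding \<gamma>_eq y_def using x M D by (simp add: a_minus_def minus_add a_ac)
  \<comment> \<open>The cross terms \<open>ip H D y\<close> and \<open>- ip H y D\<close> add up to
    a purely imaginary number, leaving a difference of squares.\<close>
  have "Re (ip H (D \<ominus>\<^bsub>H\<^esub> y) (y \<oplus>\<^bsub>H\<^esub> D)) = (ip_norm H D)\<^sup>2 - (ip_norm H y)\<^sup>2"
    using y D ip_commute[of y D]
    by (simp add: a_minus_def ip_add_left ip_add_right ip_uminus_left ip_norm_sq)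
  then have "0 \<le> Re (ip H (D \<ominus>\<^bsub>H\<^esub> y) (y \<oplus>\<^bsub>H\<^esub> D)) \<longleftrightarrow> ip_norm H y \<le> ip_norm H D"
    using y D by (simp add: ip_norm_nonneg)
  then show "ip_norm H (x \<ominus>\<^bsub>H\<^esub> expansion H e (\<lambda>i. (\<Gamma> i + \<gamma> i) / 2))
      \<le> 1 / 2 * sqrt (\<Sum>i. (cmod (\<Gamma> i - \<gamma> i))\<^sup>2) \<longleftrightarrow>
    0 \<le> Re (ip H (expansion H e \<Gamma> \<ominus>\<^bsub>H\<^esub> x) (x \<ominus>\<^bsub>H\<^esub> expansion H e \<gamma>))"
    unfolding 1 2 nD y_def M_def m_def by simp
  define S where "S = sqrt (\<Sum>i. (cmod (ip H x (e i)))\<^sup>2)"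
  define Q where "Q = (\<Sum>i. (cmod (\<Gamma> i - \<gamma> i))\<^sup>2)"
  assume ne: "\<Gamma> \<noteq> (\<lambda>i. - \<gamma> i)" 
    and ball: "ip_norm H (x \<ominus>\<^bsub>H\<^esub> expansion H e (\<lambda>i. (\<Gamma> i + \<gamma> i) / 2))
      \<le> 1 / 2 * sqrt (\<Sum>i. (cmod (\<Gamma> i - \<gamma> i))\<^sup>2)"
  \<comment> \<open>Here \<open>\<Gamma> \<noteq> -\<gamma>\<close> enters: it makes
    \<open>M\<close> nonzero, so that the final division is legitimate.\<close>
  have "0 < (\<Sum>i. (cmod (\<Gamma> i + \<gamma> i))\<^sup>2)"
  proof -
    obtain i where "\<Gamma> i \<noteq> - \<gamma> i" using ne by auto
    then have "\<Gamma> i + \<gamma> i \<noteq> 0" by (simp add: add_eq_0_iff2)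
    then show ?thesis
      using sum by (intro suminf_pos2[of _ i]) (auto simp: ell2_def)
  qed
  then have pos: "0 < ip_norm H M" unfolding nM by simp
  have Q: "0 \<le> Q" unfolding Q_def using diff by (intro suminf_nonneg) (auto simp: ell2_def)
  have "(ip_norm H y)\<^sup>2 \<le> (ip_norm H D)\<^sup>2"
    using ball y unfolding nD y_def M_def m_def by (intro power_mono ip_norm_nonneg)
  also have "\<dots> = Q / 4"
    unfolding nD using Q by (simp add: Q_def power_mult_distrib power_divide)
  also have "(ip_norm H y)\<^sup>2 = (ip_norm H x)\<^sup>2 - 2 * Re (ip H x M) + (ip_norm H M)\<^sup>2"
    unfolding y_def a_minus_def using x M by (simp add: ip_norm_add_sq ip_uminus_right ip_norm_uminus)
  finally have "(ip_norm H x)\<^sup>2 + (ip_norm H M)\<^sup>2 \<le> Q / 4 + 2 * (S * ip_norm H M)"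
    using Re_ip_expansion_le[OF K e m x] by (simp add: S_def M_def)
  then have "2 * (ip_norm H x * ip_norm H M) \<le> Q / 4 + 2 * (S * ip_norm H M)"
    using sum_squares_bound[of "ip_norm H x" "ip_norm H M"] by simp
  \<comment> \<open>The denominator is kept as \<open>2 * ip_norm H M\<close> because by
    \<open>nM\<close> this is exactly the root of the square sum of
    \<open>\<Gamma> + \<gamma>\<close>.\<close>
  then have "ip_norm H x - S \<le> 1 / 4 * (Q / (2 * ip_norm H M))"
    using pos by (simp add: field_simps)
  then show "ip_norm H x - sqrt (\<Sum>i. (cmod (ip H x (e i)))\<^sup>2)
         \<le> 1 / 4 * ((\<Sum>i. (cmod (\<Gamma> i - \<gamma> i))\<^sup>2) / sqrt (\<Sum>i. (cmod (\<Gamma> i + \<gamma> i))\<^sup>2))"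
    unfolding nM S_def Q_def by simp
qed

end


section \<open>The sequence space as a concrete Hilbert space over \<open>K\<close>\<close>

text \<open>Its element type is the one over which the sharpness claim quantifies, so this space can
  refute a smaller constant for either choice of \<open>K\<close>.\<close>

definition ell2_space :: "complex set \<Rightarrow> (nat \<Rightarrow> complex) ip_space" where
  "ell2_space K = \<lparr>carrier = ell2 K, mult = (\<lambda>a b. a), one = (\<lambda>i. 0), zero = (\<lambda>i. 0),
     add = (\<lambda>a b i. a i + b i), smult = (\<lambda>c a i. c * a i), ip = (\<lambda>a b. \<Sum>i. a i * cnj (b i))\<rparr>"

lemma field_scalars:
  assumes K: "K = \<real> \<or> K = UNIV"
  shows "field (scalars K)"
proof -
  have "cring (scalars K)"
  proof (intro cringI abelian_groupI comm_monoidI)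
    fix x assume "x \<in> carrier (scalars K)"
    then show "\<exists>y\<in>carrier (scalars K). y \<oplus>\<^bsub>scalars K\<^esub> x = \<zero>\<^bsub>scalars K\<^esub>"
      using K by (intro bexI[of _ "- x"]) (auto simp: scalars_def)
  qed (use K in \<open>auto simp: scalars_def algebra_simps\<close>)
  then show ?thesis
  proof (rule cring.cring_fieldI2)
    fix a assume "a \<in> carrier (scalars K)" "a \<noteq> \<zero>\<^bsub>scalars K\<^esub>"
    then show "\<exists>b\<in>carrier (scalars K). a \<otimes>\<^bsub>scalars K\<^esub> b = \<one>\<^bsub>scalars K\<^esub>"
      using K by (intro bexI[of _ "1 / a"]) (auto simp: scalars_def intro!: Reals_divide)
  qed (simp add: scalars_def)
qed

text \<open>A product of moduli is at most the sum of their squares. Every termwise manipulation of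
  \<open>ip\<close> on sequences relies on this, since \<open>suminf\<close> behaves linearly only
  on convergent series.\<close>

lemma summable_ell2_mult:
  assumes "a \<in> ell2 K" "b \<in> ell2 K"
  shows "summable (\<lambda>i. a i * cnj (b i))"
proof -
  have bound: "norm (a i * cnj (b i)) \<le> (cmod (a i))\<^sup>2 + (cmod (b i))\<^sup>2" for i
  proof -
    have "0 \<le> cmod (a i) * cmod (b i)" by simp
    then show ?thesis
      using sum_squares_bound[of "cmod (a i)" "cmod (b i)"]
      unfolding norm_mult complex_mod_cnj by linarith
  qed
  have "summable (\<lambda>i. (cmod (a i))\<^sup>2 + (cmod (b i))\<^sup>2)"
    using assms by (intro summable_add) (simp_all add: ell2_def)
  then show ?thesis
    using bound by (rule summable_comparison_test'[where N = 0])
qed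

lemma ip_ell2_self:
  assumes "a \<in> ell2 K"
  shows "ip (ell2_space K) a a = of_real (\<Sum>i. (cmod (a i))\<^sup>2)"
proof -
  have "summable (\<lambda>i. (cmod (a i))\<^sup>2)" using assms by (simp add: ell2_def)
  from suminf_of_real[OF this, where 'a = complex] show ?thesis
    by (simp add: ell2_space_def complex_norm_square del: of_real_power)
qed

lemma inner_product_space_ell2:
  assumes K: "K = \<real> \<or> K = UNIV"
  shows "inner_product_space K (ell2_space K)"
proof -
  interpret F: field "scalars K" by (rule field_scalars[OF K])
  have zero: "(\<lambda>i. 0) \<in> ell2 K" using K by (auto simp: ell2_def)
  have neg: "\<exists>w\<in>ell2 K. (\<lambda>i. v i + w i) = (\<lambda>i. 0)" if "v \<in> ell2 K" for v
    using ell2_scale[OF K _ that, of "-1"] K by (intro bexI[of _ "\<lambda>i. - v i"]) auto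
  have "module (scalars K) (ell2_space K)"
    using zero neg
    by (intro module_criteria F.cring_axioms)
      (auto simp: ell2_space_def scalars_def algebra_simps intro: ell2_add[OF K] ell2_scale[OF K])
  then interpret V: vectorspace "scalars K" "ell2_space K"
    by (simp add: vectorspace_def F.field_axioms)
  show ?thesis
  proof
    fix x y assume x: "x \<in> carrier (ell2_space K)" and y: "y \<in> carrier (ell2_space K)"
    note xy = summable_ell2_mult[of x K y]
    show "ip (ell2_space K) x y \<in> K"
    proof (cases "K = UNIV")
      \<comment> \<open>Over the reals each term equals its own real part, so the series is the
        embedding of a real series.\<close>
      case False
      then have "x i * cnj (y i) \<in> \<real>" for i
        using K x y by (auto simp: ell2_space_def ell2_def Reals_cnj_iff)
      then have "(\<lambda>i. x i * cnj (y i)) = (\<lambda>i. of_real (Re (x i * cnj (y i))))"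
        by (metis of_real_Re)
      moreover have "summable (\<lambda>i. x i * cnj (y i))"
        using x y by (intro xy) (simp_all add: ell2_space_def)
      ultimately have "(\<Sum>i. x i * cnj (y i)) = of_real (\<Sum>i. Re (x i * cnj (y i)))"
        using suminf_of_real[OF summable_Re, of "\<lambda>i. x i * cnj (y i)", where 'a = complex] by metis
      then show ?thesis using False K by (auto simp: ell2_space_def)
    qed simp
    show "ip (ell2_space K) y x = cnj (ip (ell2_space K) x y)"
      using bounded_linear.suminf[OF bounded_linear_cnj xy] x y by (simp add: ell2_space_def mult.commute)
    { fix z assume "z \<in> carrier (ell2_space K)"
      then show "ip (ell2_space K) (x \<oplus>\<^bsub>ell2_space K\<^esub> y) z =
          ip (ell2_space K) x z + ip (ell2_space K) y z"
        using x y suminf_add[OF summable_ell2_mult[of x K z] summable_ell2_mult[of y K z]]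
        by (simp add: ell2_space_def algebra_simps)
    }
    { fix c assume "c \<in> K"
      show "ip (ell2_space K) (c \<odot>\<^bsub>ell2_space K\<^esub> x) y = c * ip (ell2_space K) x y"
        using x y suminf_mult[OF xy, of c] by (simp add: ell2_space_def mult.assoc)
    }
  next
    fix x assume x: "x \<in> carrier (ell2_space K)"
    then have sx: "summable (\<lambda>i. (cmod (x i))\<^sup>2)" by (simp add: ell2_space_def ell2_def)
    have ip: "ip (ell2_space K) x x = of_real (\<Sum>i. (cmod (x i))\<^sup>2)"
      using x by (intro ip_ell2_self) (simp add: ell2_space_def)
    then show "0 \<le> Re (ip (ell2_space K) x x)"
      using sx by (simp add: suminf_nonneg)
    assume "ip (ell2_space K) x x = 0"
    then have "(\<Sum>i. (cmod (x i))\<^sup>2) = 0"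
      unfolding ip by (simp only: of_real_eq_0_iff)
    then have "\<forall>i. (cmod (x i))\<^sup>2 = 0"
      using suminf_eq_zero_iff[OF sx] by simp
    then show "x = \<zero>\<^bsub>ell2_space K\<^esub>"
      by (auto simp: ell2_space_def)
  qed
qed

text \<open>Subtraction in the record is determined only through additive inverses, so it is first
  identified with pointwise subtraction.\<close>

lemma ip_dist_ell2:
  assumes K: "K = \<real> \<or> K = UNIV" and a: "a \<in> ell2 K" and b: "b \<in> ell2 K"
  shows "ip_dist (ell2_space K) a b = sqrt (\<Sum>i. (cmod (a i - b i))\<^sup>2)"
    and "summable (\<lambda>i. (cmod (a i - b i))\<^sup>2)"
proof -
  interpret inner_product_space K "ell2_space K" by (rule inner_product_space_ell2[OF K])
  have b': "(\<lambda>i. - b i) \<in> ell2 K"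
    using ell2_scale[OF K _ b, of "-1"] K by auto
  have "\<ominus>\<^bsub>ell2_space K\<^esub> b = (\<lambda>i. - b i)"
    using b b' by (intro minus_equality) (auto simp: ell2_space_def)
  then have diff: "a \<ominus>\<^bsub>ell2_space K\<^esub> b = (\<lambda>i. a i - b i)"
    by (simp add: a_minus_def) (simp add: ell2_space_def)
  show s: "summable (\<lambda>i. (cmod (a i - b i))\<^sup>2)"
    using ell2_add[OF K a b'] by (simp add: ell2_def)
  have "ip (ell2_space K) (\<lambda>i. a i - b i) (\<lambda>i. a i - b i) = of_real (\<Sum>i. (cmod (a i - b i))\<^sup>2)"
    using ell2_add[OF K a b'] by (intro ip_ell2_self) simp
  then show "ip_dist (ell2_space K) a b = sqrt (\<Sum>i. (cmod (a i - b i))\<^sup>2)"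
    using a b diff by (simp add: ip_dist_def ip_norm_def) (simp add: ell2_space_def)
qed

text \<open>The usual completeness argument: a Cauchy sequence converges in each coordinate, and the
  Cauchy estimate on finite blocks of coordinates passes to the coordinatewise limit before the
  block grows.\<close>

lemma hilbert_space_ell2:
  assumes K: "K = \<real> \<or> K = UNIV"
  shows "hilbert_space K (ell2_space K)"
proof -
  interpret inner_product_space K "ell2_space K" by (rule inner_product_space_ell2[OF K])
  interpret M: Metric_space "carrier (ell2_space K)" "ip_dist (ell2_space K)"
    by (rule Metric_space[OF K])
  have car: "carrier (ell2_space K) = ell2 K" by (simp add: ell2_space_def)
  have "\<exists>x. limitin M.mtopology X x sequentially" if X: "M.MCauchy X" for X
  proof -
    have X': "X n \<in> ell2 K" for n using X unfolding M.MCauchy_def by (auto simp: car)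
    have sum_le: "(\<Sum>k<j. (cmod (X n k - X m k))\<^sup>2) \<le> (ip_dist (ell2_space K) (X n) (X m))\<^sup>2"
      for n m j
    proof -
      have "(\<Sum>k<j. (cmod (X n k - X m k))\<^sup>2) \<le> (\<Sum>k. (cmod (X n k - X m k))\<^sup>2)"
        using ip_dist_ell2(2)[OF K X' X'] by (intro sum_le_suminf) auto
      then show ?thesis
        using ip_dist_ell2[OF K X' X', of n m] by (simp add: suminf_nonneg)
    qed
    have "\<forall>\<epsilon>>0. \<exists>N. \<forall>n m. N \<le> n \<longrightarrow> N \<le> m \<longrightarrow> ip_dist (ell2_space K) (X n) (X m) < \<epsilon>"
      using X unfolding M.MCauchy_def by (rule conjunct2)
    then have cauchy: "\<exists>N. \<forall>n m. N \<le> n \<longrightarrow> N \<le> m \<longrightarrow> ip_dist (ell2_space K) (X n) (X m) < \<epsilon>"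
      if "\<epsilon> > 0" for \<epsilon>
      using that by simp
    have "Cauchy (\<lambda>n. X n k)" for k
    proof (rule metric_CauchyI)
      fix \<epsilon> :: real assume "\<epsilon> > 0"
      then obtain N where N: "\<And>n m. n \<ge> N \<Longrightarrow> m \<ge> N \<Longrightarrow> ip_dist (ell2_space K) (X n) (X m) < \<epsilon>"
        using cauchy by blast
      have le: "cmod (X n k - X m k) \<le> ip_dist (ell2_space K) (X n) (X m)" for n m
      proof (rule power2_le_imp_le)
        have "(cmod (X n k - X m k))\<^sup>2 \<le> (\<Sum>k<Suc k. (cmod (X n k - X m k))\<^sup>2)"
          by (simp add: sum_nonneg)
        then show "(cmod (X n k - X m k))\<^sup>2 \<le> (ip_dist (ell2_space K) (X n) (X m))\<^sup>2"
          using sum_le order_trans by blast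
      qed simp
      have "dist (X m k) (X n k) < \<epsilon>" if "m \<ge> N" "n \<ge> N" for m n
        using le[of m n] N[OF that] by (simp add: dist_norm)
      then show "\<exists>N. \<forall>m\<ge>N. \<forall>n\<ge>N. dist (X m k) (X n k) < \<epsilon>" by blast
    qed
    then obtain a where a: "\<And>k. (\<lambda>n. X n k) \<longlonglongrightarrow> a k"
      unfolding Cauchy_convergent_iff convergent_def by metis
    \<comment> \<open>The reals are closed in the complex plane, so coordinatewise limits stay in
      \<open>K\<close>.\<close>
    have aK: "a k \<in> K" for k
    proof (cases "K = UNIV")
      case False
      then have "X n k \<in> \<real>" for n using X'[of n] K by (auto simp: ell2_def)
      then have "a k \<in> \<real>"
        using closed_sequentially[OF closed_complex_Reals, of "\<lambda>n. X n k"] a by blast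
      then show ?thesis using K False by auto
    qed simp
    \<comment> \<open>With \<open>n\<close> and the block length \<open>j\<close> fixed,
      \<open>m\<close> tends to infinity; the block is finite, so the limit is taken term by
      term.\<close>
    have tail: "(\<Sum>k<j. (cmod (X n k - a k))\<^sup>2) \<le> \<epsilon>\<^sup>2"
      if close: "\<And>m. m \<ge> N \<Longrightarrow> ip_dist (ell2_space K) (X n) (X m) < \<epsilon>" for n N \<epsilon> j
    proof (rule LIMSEQ_le_const2)
      show "(\<lambda>m. \<Sum>k<j. (cmod (X n k - X m k))\<^sup>2) \<longlonglongrightarrow> (\<Sum>k<j. (cmod (X n k - a k))\<^sup>2)"
        by (intro tendsto_intros a)
      have "(\<Sum>k<j. (cmod (X n k - X m k))\<^sup>2) \<le> \<epsilon>\<^sup>2" if "m \<ge> N" for m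
      proof -
        have "(\<Sum>k<j. (cmod (X n k - X m k))\<^sup>2) \<le> (ip_dist (ell2_space K) (X n) (X m))\<^sup>2"
          by (rule sum_le)
        also have "\<dots> \<le> \<epsilon>\<^sup>2"
          using close[OF that] by (intro power_mono) auto
        finally show ?thesis .
      qed
      then show "\<exists>N. \<forall>m\<ge>N. (\<Sum>k<j. (cmod (X n k - X m k))\<^sup>2) \<le> \<epsilon>\<^sup>2" by blast
    qed
    have tail_summable: "summable (\<lambda>k. (cmod (X n k - a k))\<^sup>2)"
      if "\<And>m. m \<ge> N \<Longrightarrow> ip_dist (ell2_space K) (X n) (X m) < \<epsilon>" for n N \<epsilon>
    proof (rule bounded_imp_summable)
      show "(\<Sum>k\<le>j. (cmod (X n k - a k))\<^sup>2) \<le> \<epsilon>\<^sup>2" for j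
        unfolding lessThan_Suc_atMost[symmetric] using that by (rule tail)
    qed simp
    \<comment> \<open>The limit is \<open>X N\<close> minus the square-summable difference
      \<open>X N - a\<close>.\<close>
    have a2: "a \<in> ell2 K"
    proof -
      obtain N where N: "\<And>m. m \<ge> N \<Longrightarrow> ip_dist (ell2_space K) (X N) (X m) < 1"
        using cauchy[of 1] by auto
      have "(\<lambda>k. X N k - a k) \<in> ell2 K"
        using tail_summable[OF N] aK X'[of N] K by (auto simp: ell2_def)
      then have "(\<lambda>k. - 1 * (X N k - a k)) \<in> ell2 K"
        using K by (intro ell2_scale) auto
      from ell2_add[OF K X'[of N] this] show ?thesis by simp
    qed
    have "limitin M.mtopology X a sequentially"
      unfolding M.limit_metric_sequentially
    proof (intro conjI allI impI)
      fix \<epsilon> :: real assume "\<epsilon> > 0"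
      \<comment> \<open>The limit in \<open>tail\<close> leaves only a non-strict bound;
        \<open>\<epsilon> / 2\<close> recovers strictness.\<close>
      then obtain N where N: "\<And>n m. n \<ge> N \<Longrightarrow> m \<ge> N \<Longrightarrow>
          ip_dist (ell2_space K) (X n) (X m) < \<epsilon> / 2"
        using cauchy[of "\<epsilon> / 2"] by auto
      have "ip_dist (ell2_space K) (X n) a < \<epsilon>" if "n \<ge> N" for n
      proof -
        have "(\<Sum>k. (cmod (X n k - a k))\<^sup>2) \<le> (\<epsilon> / 2)\<^sup>2"
          using tail[OF N[OF that]] ip_dist_ell2(2)[OF K X' a2] by (intro suminf_le_const)
        then have "ip_dist (ell2_space K) (X n) a \<le> \<epsilon> / 2"
          unfolding ip_dist_ell2(1)[OF K X' a2] using \<open>\<epsilon> > 0\<close> by (intro real_le_lsqrt) auto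
        then show ?thesis using \<open>\<epsilon> > 0\<close> by simp
      qed
      then show "\<exists>N. \<forall>n\<ge>N. X n \<in> carrier (ell2_space K) \<and> ip_dist (ell2_space K) (X n) a < \<epsilon>"
        unfolding car using X' by blast
    qed (simp add: a2 car)
    then show ?thesis by (rule exI[of _ a])
  qed
  then show ?thesis
    by unfold_locales (simp add: M.mcomplete_def)
qed

text \<open>The unit vectors serve twice: they show that the space is infinite dimensional, and the
  extremal example is built from them.\<close>

lemma orthonormal_ell2:
  assumes K: "K = \<real> \<or> K = UNIV"
  shows "orthonormal_family (ell2_space K) (\<lambda>j i. if i = j then 1 else 0)"
proof -
  have "(\<Sum>k. (if k = i then 1 else 0) * cnj (if k = j then 1 else 0)) = (if i = j then 1 else 0)"
    for i j :: nat
  proof -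
    have "(\<Sum>k. (if k = i then 1 else 0) * cnj (if k = j then 1 else 0)) =
        (\<Sum>k\<in>{i}. (if k = i then 1 else 0) * cnj (if k = j then 1 else 0))"
      by (rule suminf_finite) auto
    then show ?thesis by simp
  qed
  moreover have "summable (\<lambda>i. (cmod (if i = j then 1 else 0))\<^sup>2)" for j :: nat
    by (rule summable_finite[of "{j}"]) auto
  ultimately show ?thesis
    using K by (auto simp: orthonormal_family_def ell2_space_def ell2_def ip_norm_def)
qed

section \<open>Sharpness of the constant 1/4\<close>

text \<open>With \<open>M\<close> and \<open>D\<close> as above, equality holds when \<open>\<parallel>x\<parallel> = \<parallel>M\<parallel>\<close>, \<open>\<parallel>x - M\<parallel> = \<parallel>D\<parallel>\<close> and the
  projection of \<open>x\<close> onto the family is a multiple of \<open>M\<close>. The numbers come from the Pythagorean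
  triple 7, 24, 25, with \<open>u 0\<close> orthogonal to the family \<open>\<lambda>i. u (Suc i)\<close>.\<close>

lemma (in hilbert_space) reverse_Bessel_sharp:
  assumes K: "K = \<real> \<or> K = UNIV" and u: "orthonormal_family H u"
  obtains e \<Gamma> \<gamma> x where "orthonormal_family H e" "\<Gamma> \<in> ell2 K" "\<gamma> \<in> ell2 K" "\<Gamma> \<noteq> \<gamma>"
    "\<Gamma> \<noteq> (\<lambda>i. - \<gamma> i)" "x \<in> carrier H"
    "0 \<le> Re (ip H (expansion H e \<Gamma> \<ominus>\<^bsub>H\<^esub> x) (x \<ominus>\<^bsub>H\<^esub> expansion H e \<gamma>))"
    "ip_norm H x - sqrt (\<Sum>i. (cmod (ip H x (e i)))\<^sup>2) = 18 / 25"
    "(\<Sum>i. (cmod (\<Gamma> i - \<gamma> i))\<^sup>2) / sqrt (\<Sum>i. (cmod (\<Gamma> i + \<gamma> i))\<^sup>2) = 72 / 25"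
proof
  define e where "e = (\<lambda>i. u (Suc i))"
  \<comment> \<open>Index 0 of \<open>e\<close> is \<open>u 1\<close>, so the sequence
    \<open>\<delta> c\<close> represents \<open>c\<close> times \<open>u 1\<close>.\<close>
  define \<delta> where "\<delta> = (\<lambda>(c::complex) (i::nat). if i = 0 then c else 0)"
  \<comment> \<open>For coefficients 11/5 and -1/5, \<open>M\<close> is \<open>u 1\<close> and
    \<open>D\<close> is 6/5 times \<open>u 1\<close>. The unit vector \<open>x\<close> differs from
    \<open>M\<close> by coordinates 24/25 and -18/25, a vector of length 30/25 = 6/5.\<close>
  define x where "x = (24 / 25) \<odot>\<^bsub>H\<^esub> u 0 \<oplus>\<^bsub>H\<^esub> (7 / 25) \<odot>\<^bsub>H\<^esub> u 1"
  have in_K: "24 / 25 \<in> K" "7 / 25 \<in> K" "11 / 5 \<in> K" "- 1 / 5 \<in> K" "0 \<in> K"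
    using K by (auto intro!: Reals_divide)
  have uH: "u i \<in> carrier H" for i using u by (simp add: orthonormal_family_def)
  have sum_\<delta>: "(\<Sum>i. (cmod (\<delta> c i))\<^sup>2) = (cmod c)\<^sup>2" for c
    using suminf_finite[of "{0}" "\<lambda>i. (cmod (\<delta> c i))\<^sup>2"] by (simp add: \<delta>_def)
  have \<delta>_in: "\<delta> c \<in> ell2 K" if "c \<in> K" for c
    using that in_K(5) summable_finite[of "{0}" "\<lambda>i. (cmod (\<delta> c i))\<^sup>2"]
    by (simp add: \<delta>_def ell2_def)
  show e: "orthonormal_family H e"
    using u by (simp add: orthonormal_family_def e_def)
  have expand: "expansion H e (\<delta> c) = c \<odot>\<^bsub>H\<^esub> u 1" if "c \<in> K" for c
    using expansion_single[OF K e that, of 0] by (simp add: \<delta>_def e_def)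
  show "\<delta> (11 / 5) \<in> ell2 K" "\<delta> (- 1 / 5) \<in> ell2 K"
    by (intro \<delta>_in in_K)+
  show "\<delta> (11 / 5) \<noteq> \<delta> (- 1 / 5)" "\<delta> (11 / 5) \<noteq> (\<lambda>i. - \<delta> (- 1 / 5) i)"
    by (auto simp: \<delta>_def fun_eq_iff)
  show x: "x \<in> carrier H"
    unfolding x_def using in_K uH by (intro a_closed smult_in)
  note ip_simps = ip_add_left ip_add_right ip_smult_left ip_smult_right ip_uminus_left
    ip_uminus_right ip_orthonormal[OF u] a_minus_def
  have v: "(11 / 5) \<odot>\<^bsub>H\<^esub> u 1 \<in> carrier H" "(- 1 / 5) \<odot>\<^bsub>H\<^esub> u 1 \<in> carrier H"
    "(24 / 25) \<odot>\<^bsub>H\<^esub> u 0 \<in> carrier H" "(7 / 25) \<odot>\<^bsub>H\<^esub> u 1 \<in> carrier H"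
    by (intro smult_in in_K uH)+
  \<comment> \<open>The real part is exactly 0: \<open>x\<close> lies on the boundary of the
    ball.\<close>
  show "0 \<le> Re (ip H (expansion H e (\<delta> (11 / 5)) \<ominus>\<^bsub>H\<^esub> x) (x \<ominus>\<^bsub>H\<^esub> expansion H e (\<delta> (- 1 / 5))))"
    unfolding expand[OF in_K(3)] expand[OF in_K(4)] x_def
    using v uH in_K by (simp only: ip_simps a_closed a_inv_closed minus_add) simp
  have "ip_norm H x = 1"
    unfolding ip_norm_def x_def using v uH in_K by (simp only: ip_simps a_closed) simp
  moreover have "ip H x (e i) = \<delta> (7 / 25) i" for i
    unfolding x_def e_def \<delta>_def using v uH in_K by (simp only: ip_simps) simp
  ultimately show "ip_norm H x - sqrt (\<Sum>i. (cmod (ip H x (e i)))\<^sup>2) = 18 / 25"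
    by (simp add: sum_\<delta> norm_divide)
  have "(\<lambda>i. \<delta> (11 / 5) i - \<delta> (- 1 / 5) i) = \<delta> (12 / 5)" "(\<lambda>i. \<delta> (11 / 5) i + \<delta> (- 1 / 5) i) = \<delta> 2"
    by (auto simp: \<delta>_def)
  then have "(\<Sum>i. (cmod (\<delta> (11 / 5) i - \<delta> (- 1 / 5) i))\<^sup>2) = (12 / 5)\<^sup>2"
    "(\<Sum>i. (cmod (\<delta> (11 / 5) i + \<delta> (- 1 / 5) i))\<^sup>2) = 2\<^sup>2"
    using sum_\<delta>[of "12 / 5"] sum_\<delta>[of 2] by (simp_all add: fun_eq_iff norm_divide)
  then show "(\<Sum>i. (cmod (\<delta> (11 / 5) i - \<delta> (- 1 / 5) i))\<^sup>2) /
      sqrt (\<Sum>i. (cmod (\<delta> (11 / 5) i + \<delta> (- 1 / 5) i))\<^sup>2) = 72 / 25"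
    by (simp add: power2_eq_square)
qed

theorem theorem8:
  fixes K :: "complex set"
  assumes "K = \<real> \<or> K = UNIV"
  shows
    "(\<forall>(H :: 'a ip_space) e \<Gamma> \<gamma> x.
        hilbert_space K H \<and> infinite_dimensional K H \<and> orthonormal_family H e \<and>
        \<Gamma> \<in> ell2 K \<and> \<gamma> \<in> ell2 K \<and> \<Gamma> \<noteq> \<gamma> \<and> \<Gamma> \<noteq> (\<lambda>i. - \<gamma> i) \<and> x \<in> carrier H \<longrightarrow>
        (ip_norm H (x \<ominus>\<^bsub>H\<^esub> expansion H e (\<lambda>i. (\<Gamma> i + \<gamma> i) / 2))
            \<le> 1 / 2 * sqrt (\<Sum>i. (cmod (\<Gamma> i - \<gamma> i))\<^sup>2)
          \<longleftrightarrow> 0 \<le> Re (ip H (expansion H e \<Gamma> \<ominus>\<^bsub>H\<^esub> x) (x \<ominus>\<^bsub>H\<^esub> expansion H e \<gamma>))) \<and>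
        (ip_norm H (x \<ominus>\<^bsub>H\<^esub> expansion H e (\<lambda>i. (\<Gamma> i + \<gamma> i) / 2))
            \<le> 1 / 2 * sqrt (\<Sum>i. (cmod (\<Gamma> i - \<gamma> i))\<^sup>2)
          \<or> 0 \<le> Re (ip H (expansion H e \<Gamma> \<ominus>\<^bsub>H\<^esub> x) (x \<ominus>\<^bsub>H\<^esub> expansion H e \<gamma>)) \<longrightarrow>
         0 \<le> ip_norm H x - sqrt (\<Sum>i. (cmod (ip H x (e i)))\<^sup>2) \<and>
         ip_norm H x - sqrt (\<Sum>i. (cmod (ip H x (e i)))\<^sup>2)
           \<le> 1 / 4 * ((\<Sum>i. (cmod (\<Gamma> i - \<gamma> i))\<^sup>2) / sqrt (\<Sum>i. (cmod (\<Gamma> i + \<gamma> i))\<^sup>2)))) \<and>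
     \<not> (\<exists>c < 1 / 4. \<forall>(H :: (nat \<Rightarrow> complex) ip_space) e \<Gamma> \<gamma> x.
        hilbert_space K H \<and> infinite_dimensional K H \<and> orthonormal_family H e \<and>
        \<Gamma> \<in> ell2 K \<and> \<gamma> \<in> ell2 K \<and> \<Gamma> \<noteq> \<gamma> \<and> \<Gamma> \<noteq> (\<lambda>i. - \<gamma> i) \<and> x \<in> carrier H \<and>
        0 \<le> Re (ip H (expansion H e \<Gamma> \<ominus>\<^bsub>H\<^esub> x) (x \<ominus>\<^bsub>H\<^esub> expansion H e \<gamma>)) \<longrightarrow>
         ip_norm H x - sqrt (\<Sum>i. (cmod (ip H x (e i)))\<^sup>2)
           \<le> c * ((\<Sum>i. (cmod (\<Gamma> i - \<gamma> i))\<^sup>2) / sqrt (\<Sum>i. (cmod (\<Gamma> i + \<gamma> i))\<^sup>2)))"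
  (is "?upper \<and> \<not> (\<exists>c < 1 / 4. ?holds_with c)")
proof
  show ?upper
  proof (intro allI impI, elim conjE)
    fix H :: "'a ip_space" and e \<Gamma> \<gamma> x
    assume "hilbert_space K H" and *: "orthonormal_family H e" "\<Gamma> \<in> ell2 K" "\<gamma> \<in> ell2 K"
      "\<Gamma> \<noteq> (\<lambda>i. - \<gamma> i)" "x \<in> carrier H"
    then interpret hilbert_space K H by simp
    let ?ball = "ip_norm H (x \<ominus>\<^bsub>H\<^esub> expansion H e (\<lambda>i. (\<Gamma> i + \<gamma> i) / 2))
      \<le> 1 / 2 * sqrt (\<Sum>i. (cmod (\<Gamma> i - \<gamma> i))\<^sup>2)"
    let ?re = "0 \<le> Re (ip H (expansion H e \<Gamma> \<ominus>\<^bsub>H\<^esub> x) (x \<ominus>\<^bsub>H\<^esub> expansion H e \<gamma>))"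
    let ?defect = "ip_norm H x - sqrt (\<Sum>i. (cmod (ip H x (e i)))\<^sup>2)"
    let ?bound = "1 / 4 * ((\<Sum>i. (cmod (\<Gamma> i - \<gamma> i))\<^sup>2) / sqrt (\<Sum>i. (cmod (\<Gamma> i + \<gamma> i))\<^sup>2))"
    have iff: "?ball \<longleftrightarrow> ?re"
      by (rule ball_iff_Re_ip[OF assms *(1-3,5)])
    moreover have "0 \<le> ?defect"
      using Bessel(2)[OF assms *(1,5)] by simp
    moreover have "?defect \<le> ?bound" if ?ball
      by (rule reverse_Bessel[OF assms *(1-3,5,4) that])
    ultimately show "(?ball \<longleftrightarrow> ?re) \<and> (?ball \<or> ?re \<longrightarrow> 0 \<le> ?defect \<and> ?defect \<le> ?bound)"
      by blast
  qed
  let ?H = "ell2_space K"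
  note H = hilbert_space_ell2[OF assms]
  have dim: "infinite_dimensional K ?H"
    by (rule inner_product_space.orthonormal_infinite_dimensional
        [OF hilbert_space.axioms(1)[OF H] assms orthonormal_ell2[OF assms]])
  show "\<not> (\<exists>c < 1 / 4. ?holds_with c)"
  proof (intro notI, elim exE conjE)
    fix c :: real assume c: "c < 1 / 4" and le: "?holds_with c"
    obtain e \<Gamma> \<gamma> x where "orthonormal_family ?H e" "\<Gamma> \<in> ell2 K" "\<gamma> \<in> ell2 K" "\<Gamma> \<noteq> \<gamma>"
      "\<Gamma> \<noteq> (\<lambda>i. - \<gamma> i)" "x \<in> carrier ?H"
      "0 \<le> Re (ip ?H (expansion ?H e \<Gamma> \<ominus>\<^bsub>?H\<^esub> x) (x \<ominus>\<^bsub>?H\<^esub> expansion ?H e \<gamma>))"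
      and eq: "ip_norm ?H x - sqrt (\<Sum>i. (cmod (ip ?H x (e i)))\<^sup>2) = 18 / 25"
      "(\<Sum>i. (cmod (\<Gamma> i - \<gamma> i))\<^sup>2) / sqrt (\<Sum>i. (cmod (\<Gamma> i + \<gamma> i))\<^sup>2) = 72 / 25"
      by (rule hilbert_space.reverse_Bessel_sharp[OF H assms orthonormal_ell2[OF assms]])
    note H dim this(1-7)
    \<comment> \<open>The quotient of 18/25 by 72/25 is exactly 1/4, so no smaller \<open>c\<close>
      satisfies this inequality.\<close>
    with le[rule_format, of ?H e \<Gamma> \<gamma> x] have "18 / 25 \<le> c * (72 / 25)"
      unfolding eq by blast
    with c show False by simp
  qed
qed

end
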